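(* Let $\beta>0$, $M>0$, $G(s)=\exp(-\beta s)$, and let $\varrho$ be a smooth positive function on $\mathbb T^d$ with $\int_{\mathbb T^d}\varrho\,\mathrm dx=M$. Then the following statements are equivalent: (i) $\varrho$ is a stationary solution of $\partial_t\varrho=\frac12\Delta\bigl(G(W\ast\varrho)^2\varrho\bigr)$ on $\mathbb T^d$, i.e. $\Delta\bigl(G(W\ast\varrho)^2\varrho\bigr)=0$; (ii) $\varrho$ is a critical point of $\mathcal F_\beta$ under the mass constraint $\int_{\mathbb T^d}\varrho\,\mathrm dx=M$; (iii) there exists a constant $\lambda\in\mathbb R$ such that $\log\varrho-2\beta\,W\ast\varrho=\lambda$ on $\mathbb T^d$; (iv) $\varrho$ satisfies, for all $x\in\mathbb T^d$, $$\varrho(x)=M\,\frac{\exp\bigl(2\beta(W\ast\varrho)(x)\bigr)}{\displaystyle\int_{\mathbb T^d}\exp\bigl(2\beta(W\ast\varrho)(z)\bigr)\,\mathrm dz}.$$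
   Context: $\mathbb T^d=\mathbb R^d/\mathbb Z^d$. The kernel $W:\mathbb T^d\to[0,\infty)$ is bounded, radially symmetric (in particular even), nonincreasing with respect to $|x|$, obtained by periodic extension of a compactly supported function on $\mathbb R^d$, and normalized by $\int_{\mathbb T^d}W\,\mathrm dx=1$. $W\ast\varrho$ is the periodic convolution. The free energy is $$\mathcal F_\beta(\varrho)=\int_{\mathbb T^d}\varrho(\log\varrho-1)\,\mathrm dx-\beta\int_{\mathbb T^d}\varrho\,(W\ast\varrho)\,\mathrm dx .$$ Critical point under the mass constraint means $\frac{\mathrm d}{\mathrm d\varepsilon}\mathcal F_\beta(\varrho+\varepsilon\eta)\big|_{\varepsilon=0}=0$ for all smooth $\eta$ with $\int_{\mathbb T^d}\eta\,\mathrm dx=0$. *)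

theory Defs
  imports "HOL-Analysis.Analysis"
begin

text \<open>Functions on the torus \<open>\<real>\<^sup>d/\<int>\<^sup>d\<close> are represented by \<open>\<int>\<^sup>d\<close>-periodic functions on
  \<open>\<real>\<^sup>d\<close>; integrals over the torus are taken over the unit cube.\<close>

definition int_lattice :: "(real^'d) set" where
  "int_lattice = {k. \<forall>i. k $ i \<in> \<int>}"

definition periodic :: "(real^'d \<Rightarrow> real) \<Rightarrow> bool" where
  "periodic f \<longleftrightarrow> (\<forall>x. \<forall>k\<in>int_lattice. f (x + k) = f x)"

definition torus_integral :: "(real^'d \<Rightarrow> real) \<Rightarrow> real" where
  "torus_integral f = (LINT x:cbox 0 1|lborel. f x)"

text \<open>\<open>|x|\<close> on the torus: the norm of a shortest representative of \<open>x + \<int>\<^sup>d\<close>.\<close>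

definition torus_norm :: "real^'d \<Rightarrow> real" where
  "torus_norm x = infdist x int_lattice"

definition torus_conv :: "(real^'d \<Rightarrow> real) \<Rightarrow> (real^'d \<Rightarrow> real) \<Rightarrow> real^'d \<Rightarrow> real" where
  "torus_conv W f x = torus_integral (\<lambda>y. W (x - y) * f y)"

definition partial_deriv :: "'d \<Rightarrow> (real^'d \<Rightarrow> real) \<Rightarrow> real^'d \<Rightarrow> real" where
  "partial_deriv i f x = deriv (\<lambda>t. f (x + t *\<^sub>R axis i 1)) 0"

primrec Ck :: "nat \<Rightarrow> (real^'d \<Rightarrow> real) \<Rightarrow> bool" where
  "Ck 0 f \<longleftrightarrow> continuous_on UNIV f"
| "Ck (Suc k) f \<longleftrightarrow> f differentiable_on UNIV \<and> (\<forall>i. Ck k (partial_deriv i f))"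

definition smooth :: "(real^'d \<Rightarrow> real) \<Rightarrow> bool" where
  "smooth f \<longleftrightarrow> (\<forall>k. Ck k f)"

definition laplacian :: "(real^'d \<Rightarrow> real) \<Rightarrow> real^'d \<Rightarrow> real" where
  "laplacian f x = (\<Sum>i\<in>UNIV. partial_deriv i (partial_deriv i f) x)"

text \<open>For compactly supported \<open>w\<close> the lattice sum below has only finitely many nonzero terms
  at each point; if \<open>w\<close> vanishes outside one fundamental cell, it simply copies \<open>w\<close> to
  the other cells.\<close>

definition periodic_extension_of :: "(real^'d \<Rightarrow> real) \<Rightarrow> (real^'d \<Rightarrow> real) \<Rightarrow> bool" where
  "periodic_extension_of W w \<longleftrightarrow> (\<forall>x. W x = (\<Sum>\<^sub>\<infinity>k\<in>int_lattice. w (x + k)))"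

text \<open>Measurability of \<open>W\<close> is not listed: it follows from radial monotonicity. Because the
  Lebesgue integral of a non-integrable function is \<open>0\<close>, the normalization implies
  integrability.\<close>

definition interaction_kernel :: "(real^'d \<Rightarrow> real) \<Rightarrow> bool" where
  "interaction_kernel W \<longleftrightarrow>
     periodic W \<and>
     (\<forall>x. 0 \<le> W x) \<and>
     bounded (range W) \<and>
     (\<forall>x y. torus_norm x = torus_norm y \<longrightarrow> W x = W y) \<and>
     (\<forall>x y. torus_norm x \<le> torus_norm y \<longrightarrow> W y \<le> W x) \<and>
     (\<exists>w. compact (closure {x. w x \<noteq> 0}) \<and> periodic_extension_of W w) \<and>
     torus_integral W = 1"

definition free_energy :: "real \<Rightarrow> (real^'d \<Rightarrow> real) \<Rightarrow> (real^'d \<Rightarrow> real) \<Rightarrow> real" where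
  "free_energy \<beta> W \<rho> =
     torus_integral (\<lambda>x. \<rho> x * (ln (\<rho> x) - 1))
     - \<beta> * torus_integral (\<lambda>x. \<rho> x * torus_conv W \<rho> x)"

definition mass_constrained_critical_point ::
    "real \<Rightarrow> (real^'d \<Rightarrow> real) \<Rightarrow> real \<Rightarrow> (real^'d \<Rightarrow> real) \<Rightarrow> bool" where
  "mass_constrained_critical_point \<beta> W M \<rho> \<longleftrightarrow>
     torus_integral \<rho> = M \<and>
     (\<forall>\<eta>. periodic \<eta> \<longrightarrow> smooth \<eta> \<longrightarrow> torus_integral \<eta> = 0 \<longrightarrow>
        ((\<lambda>\<epsilon>. free_energy \<beta> W (\<lambda>x. \<rho> x + \<epsilon> * \<eta> x)) has_real_derivative 0) (at 0))"

text \<open>Time-independent solutions of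
  \<open>\<partial>\<^sub>t \<rho> = 1/2 \<Delta>(G(W * \<rho>)\<^sup>2 \<rho>)\<close>.\<close>

definition stationary_solution ::
    "(real \<Rightarrow> real) \<Rightarrow> (real^'d \<Rightarrow> real) \<Rightarrow> (real^'d \<Rightarrow> real) \<Rightarrow> bool" where
  "stationary_solution G W \<rho> \<longleftrightarrow>
     (\<forall>x. laplacian (\<lambda>y. (G (torus_conv W \<rho> y))\<^sup>2 * \<rho> y) x = 0)"

end

theory Submission
  imports Defs
begin

text \<open>Put \<open>g = ln \<rho> - 2 \<beta> W * \<rho>\<close>, a smooth periodic function, because convolution with the merely
  bounded \<open>W\<close> lets all derivatives fall on \<open>\<rho>\<close>. The function in the stationary equation is
  \<open>u = exp g\<close>. If \<open>u\<close> is harmonic, then integrating \<open>u \<Delta>u = 0\<close> by parts over the torus gives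
  \<open>\<integral> |\<nabla>u|\<^sup>2 = 0\<close>, so \<open>u\<close> and hence \<open>g\<close> are constant. Since \<open>W\<close> is even, the derivative of the
  free energy at \<open>\<rho>\<close> in direction \<open>\<eta>\<close> is \<open>\<integral> \<eta> g\<close>; testing with \<open>\<eta> = g - \<integral> g\<close> shows that
  critical points are those with \<open>g\<close> constant. The normalization in the last equation is
  determined by the mass.\<close>

subsection \<open>Integration over the torus\<close>

text \<open>Every class modulo the lattice has exactly one point here, whereas the closed cube in
  \<open>torus_integral\<close> repeats boundary points. Uniqueness arguments for translates
  therefore use this cube.\<close>

definition half_open_cube :: "(real^'d) set" where
  "half_open_cube = {x. \<forall>i. 0 \<le> x $ i \<and> x $ i < 1}"

text \<open>Turns set integrals over the cube into plain integrals over a finite measure space,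
  where bounded measurable functions are integrable and Fubini applies.\<close>

definition cube_measure :: "(real^'d) measure" where
  "cube_measure = restrict_space lborel (cbox 0 1)"

text \<open>The representative of \<open>x\<close> in the half-open cube; it transports facts from
  the cube to the whole space.\<close>

definition frac_vec :: "real^'d \<Rightarrow> real^'d" where
  "frac_vec x = (\<chi> i. frac (x $ i))"

lemma torus_integral_eq: "torus_integral f = integral\<^sup>L cube_measure f"
  unfolding torus_integral_def cube_measure_def set_lebesgue_integral_def
  by (subst integral_restrict_space) auto

lemma space_cube_measure [simp]: "space cube_measure = cbox 0 1"
  by (simp add: cube_measure_def space_restrict_space)

lemma borel_measurable_cube:
  "f \<in> borel_measurable borel \<Longrightarrow> f \<in> borel_measurable cube_measure"
  unfolding cube_measure_def by (intro measurable_restrict_space1) simp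

lemma emeasure_cube_measure: "emeasure (cube_measure :: (real^'d) measure) (cbox 0 1) = 1"
proof -
  have "emeasure (cube_measure :: (real^'d) measure) (cbox 0 1) = emeasure lborel (cbox 0 1 :: (real^'d) set)"
    unfolding cube_measure_def by (subst emeasure_restrict_space) auto
  also have "\<dots> = 1"
  proof -
    have "1 \<bullet> b = (1::real)" if "b \<in> Basis" for b :: "real^'d"
      using that by (auto simp: Basis_vec_def inner_axis)
    then show ?thesis by (simp add: emeasure_lborel_cbox_eq)
  qed
  finally show ?thesis .
qed

interpretation cube: finite_measure "cube_measure :: (real^'d) measure"
  by standard (simp add: emeasure_cube_measure)

lemma torus_integral_const [simp]: "torus_integral (\<lambda>_. c) = c"
  by (simp add: torus_integral_eq measure_def emeasure_cube_measure)

lemma half_open_cube_borel [measurable]: "half_open_cube \<in> sets borel"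
proof -
  have "half_open_cube = (\<Inter>i. {x::real^'d. 0 \<le> x $ i} \<inter> {x. x $ i < 1})"
    by (auto simp: half_open_cube_def)
  also have "\<dots> \<in> sets borel"
    by (intro sets.countable_INT'' sets.Int borel_closed borel_open closed_Collect_le open_Collect_less continuous_intros) auto
  finally show ?thesis .
qed

text \<open>Both cubes lie between \<open>box 0 1\<close> and \<open>cbox 0 1\<close>, which have
  the same finite volume, so they differ only on a null set.\<close>

lemma AE_half_open_cube: "AE x in lborel. x \<in> cbox 0 1 \<longleftrightarrow> x \<in> (half_open_cube :: (real^'d) set)"
proof (rule AE_I)
  have b: "box 0 1 \<subseteq> (half_open_cube :: (real^'d) set)"
    by (auto simp: half_open_cube_def mem_box_cart less_imp_le)
  have c: "(half_open_cube :: (real^'d) set) \<subseteq> cbox 0 1"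
    by (auto simp: half_open_cube_def mem_box_cart less_imp_le)
  show "{x \<in> space lborel. \<not> (x \<in> cbox 0 1 \<longleftrightarrow> x \<in> half_open_cube)} \<subseteq> cbox 0 1 - box 0 (1::real^'d)"
    using b c by auto
  have e: "emeasure lborel (box 0 (1::real^'d)) = emeasure lborel (cbox 0 (1::real^'d))"
    by (simp add: emeasure_lborel_cbox_eq emeasure_lborel_box_eq)
  have "emeasure lborel (cbox 0 1 - box 0 (1::real^'d)) =
      emeasure lborel (cbox 0 (1::real^'d)) - emeasure lborel (box 0 (1::real^'d))"
    by (rule emeasure_Diff) (auto simp: box_subset_cbox emeasure_lborel_box_eq)
  also have "\<dots> = 0"
    unfolding e by (rule ennreal_diff_self) (auto simp: emeasure_lborel_cbox_eq)
  finally show "emeasure lborel (cbox 0 1 - box 0 (1::real^'d)) = 0" .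
qed simp

section \<open>Lattice translates and fundamental domains\<close>

lemma countable_int_lattice: "countable (int_lattice :: (real^'d) set)"
proof -
  have "int_lattice \<subseteq> range (\<lambda>f :: 'd \<Rightarrow> int. (\<chi> i. of_int (f i)) :: real^'d)"
  proof
    fix k :: "real^'d" assume "k \<in> int_lattice"
    then have "k = (\<chi> i. of_int (\<lfloor>k $ i\<rfloor>))"
      by (auto simp: int_lattice_def vec_eq_iff)
    then show "k \<in> range (\<lambda>f :: 'd \<Rightarrow> int. (\<chi> i. of_int (f i)) :: real^'d)"
      by (intro range_eqI[where x = "\<lambda>i. \<lfloor>k $ i\<rfloor>"])
  qed
  then show ?thesis by (rule countable_subset) auto
qed

lemma uminus_int_lattice [simp]: "- k \<in> int_lattice \<longleftrightarrow> k \<in> int_lattice"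
  by (auto simp: int_lattice_def minus_in_Ints_iff)

lemma frac_vec_diff_lattice: "frac_vec x - x \<in> int_lattice"
  by (auto simp: frac_vec_def int_lattice_def frac_def)

lemma frac_vec_in_half_open: "frac_vec x \<in> half_open_cube"
  by (simp add: frac_vec_def half_open_cube_def frac_lt_1)

lemma half_open_cube_subset: "half_open_cube \<subseteq> cbox 0 1"
  by (auto simp: half_open_cube_def mem_box_cart less_imp_le)

lemma frac_vec_in_cbox: "frac_vec x \<in> cbox 0 1"
  using frac_vec_in_half_open half_open_cube_subset by blast

text \<open>\<open>frac\<close> ignores integer shifts and is the identity on [0,1), which forces
  each coordinate of \<open>k\<close>. Stated as an equivalence, it gives existence and uniqueness
  of the translate at once.\<close>

lemma half_open_cube_translate_unique:
  fixes k :: "real^'d"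
  shows "k \<in> int_lattice \<and> x + k \<in> half_open_cube \<longleftrightarrow> k = frac_vec x - x"
proof
  assume *: "k \<in> int_lattice \<and> x + k \<in> half_open_cube"
  have "k $ i = frac (x $ i) - x $ i" for i
  proof -
    have "frac (x $ i + k $ i) = x $ i + k $ i"
      using * by (auto simp: half_open_cube_def frac_eq)
    moreover have "frac (x $ i + k $ i) = frac (x $ i)"
      using * by (auto simp: int_lattice_def Ints_def frac_def)
    ultimately show ?thesis by simp
  qed
  then show "k = frac_vec x - x" by (simp add: vec_eq_iff frac_vec_def)
next
  assume "k = frac_vec x - x"
  then show "k \<in> int_lattice \<and> x + k \<in> half_open_cube"
    using frac_vec_diff_lattice[of x] frac_vec_in_half_open[of x] by simp
qed

text \<open>The translates of a fundamental domain form a partition of unity: only one lattice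
  vector contributes to the sum.\<close>

lemma nn_integral_count_space_translates:
  fixes x :: "real^'d"
  assumes "\<exists>!k. k \<in> int_lattice \<and> x + k \<in> A"
  shows "(\<integral>\<^sup>+k. indicator A (x + k) \<partial>count_space int_lattice) = (1::ennreal)"
proof -
  obtain k where k: "k \<in> int_lattice \<and> x + k \<in> A"
    and u: "\<forall>l. l \<in> int_lattice \<and> x + l \<in> A \<longrightarrow> l = k"
    using assms by (rule ex1E)
  have "(\<integral>\<^sup>+l. indicator A (x + l) \<partial>count_space int_lattice)
      = (\<integral>\<^sup>+l. indicator {k} l \<partial>count_space int_lattice)"
  proof (rule nn_integral_cong)
    fix l :: "real^'d" assume "l \<in> space (count_space int_lattice)"
    then have "x + l \<in> A \<longleftrightarrow> l = k" using k u by (metis space_count_space)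
    then show "indicator A (x + l) = (indicator {k} l :: ennreal)"
      by (simp only: indicator_def singleton_iff)
  qed
  also have "\<dots> = 1" using k by simp
  finally show ?thesis .
qed

lemma nn_integral_translate:
  fixes c :: "'a::euclidean_space" and f :: "'a \<Rightarrow> ennreal"
  assumes [measurable]: "f \<in> borel_measurable borel"
  shows "(\<integral>\<^sup>+x. f (c + x) \<partial>lborel) = (\<integral>\<^sup>+x. f x \<partial>lborel)"
proof -
  have "(\<integral>\<^sup>+x. f x \<partial>lborel) = (\<integral>\<^sup>+x. f x \<partial>distr lborel borel ((+) c))"
    by (simp only: lborel_distr_plus)
  then show ?thesis by (simp add: nn_integral_distr)
qed

text \<open>An affine substitution with factor -1, whose Jacobian has absolute value 1.\<close>

lemma nn_integral_reflect:
  fixes c :: "'a::euclidean_space" and f :: "'a \<Rightarrow> ennreal"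
  assumes [measurable]: "f \<in> borel_measurable borel"
  shows "(\<integral>\<^sup>+x. f (c - x) \<partial>lborel) = (\<integral>\<^sup>+x. f x \<partial>lborel)"
proof -
  have "lborel = distr lborel borel (\<lambda>x. c - x)"
    using lborel_affine[of "-1" c] by (simp add: density_1)
  then have "(\<integral>\<^sup>+x. f x \<partial>lborel) = (\<integral>\<^sup>+x. f x \<partial>distr lborel borel (\<lambda>x. c - x))"
    by (rule arg_cong)
  then show ?thesis by (simp add: nn_integral_distr)
qed

text \<open>Unfold \<open>1 = (\<Sum>k. indicator B (x + k))\<close>, interchange sum and integral, translate by \<open>k\<close> and
  sum up the translates of \<open>A\<close>.\<close>

lemma nn_integral_fundamental_domain:
  fixes F :: "real^'d \<Rightarrow> ennreal"
  assumes [measurable]: "F \<in> borel_measurable borel" "A \<in> sets borel" "B \<in> sets borel"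
    and per: "\<And>x k. k \<in> int_lattice \<Longrightarrow> F (x + k) = F x"
    and A: "\<And>x. \<exists>!k. k \<in> int_lattice \<and> x + k \<in> A"
    and B: "\<And>x. \<exists>!k. k \<in> int_lattice \<and> x + k \<in> B"
  shows "(\<integral>\<^sup>+x. F x * indicator A x \<partial>lborel) = (\<integral>\<^sup>+x. F x * indicator B x \<partial>lborel)"
proof -
  have um: "z \<in> uminus ` A \<longleftrightarrow> - z \<in> A" for z :: "real^'d" and A
    by (metis (no_types) add.inverse_inverse image_iff)
  have "\<exists>!k. k \<in> int_lattice \<and> x + k \<in> uminus ` A" if A: "\<And>x. \<exists>!k. k \<in> int_lattice \<and> x + k \<in> A" for A :: "(real^'d) set" and x
  proof -
    have m: "x + k \<in> uminus ` A \<longleftrightarrow> - x + - k \<in> A" for k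
      by (simp add: um)
    obtain k where k: "k \<in> int_lattice \<and> - x + k \<in> A"
      and u: "\<forall>l. l \<in> int_lattice \<and> - x + l \<in> A \<longrightarrow> l = k"
      using A[of "-x"] by (rule ex1E)
    have "- k \<in> int_lattice \<and> x + - k \<in> uminus ` A" using k by (simp add: um)
    moreover have "l = - k" if "l \<in> int_lattice \<and> x + l \<in> uminus ` A" for l
    proof -
      have "- l \<in> int_lattice \<and> - x + - l \<in> A" using that by (simp add: um)
      then have "- l = k" using u by blast
      then show ?thesis by auto
    qed
    ultimately show ?thesis by (rule ex1I)
  qed
  then have A': "\<exists>!k. k \<in> int_lattice \<and> x + k \<in> uminus ` A" for x using A by this
  have ind: "indicator A (x - k) = (indicator (uminus ` A) (- x + k) :: ennreal)" for x k
    by (simp add: indicator_def um)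
  have "(\<integral>\<^sup>+x. F x * indicator A x \<partial>lborel)
      = (\<integral>\<^sup>+x. F x * indicator A x * (\<integral>\<^sup>+k. indicator B (x + k) \<partial>count_space int_lattice) \<partial>lborel)"
    by (simp add: nn_integral_count_space_translates[OF B])
  also have "\<dots> = (\<integral>\<^sup>+x. (\<integral>\<^sup>+k. F x * indicator A x * indicator B (x + k) \<partial>count_space int_lattice) \<partial>lborel)"
    by (simp add: nn_integral_cmult)
  also have "\<dots> = (\<integral>\<^sup>+k. (\<integral>\<^sup>+x. F x * indicator A x * indicator B (x + k) \<partial>lborel) \<partial>count_space int_lattice)"
    by (rule nn_integral_count_space_nn_integral[OF countable_int_lattice]) measurable
  also have "\<dots> = (\<integral>\<^sup>+k. (\<integral>\<^sup>+x. F x * indicator B x * indicator A (x - k) \<partial>lborel) \<partial>count_space int_lattice)"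
  proof (rule nn_integral_cong)
    fix k :: "real^'d" assume k: "k \<in> space (count_space int_lattice)"
    have "(\<integral>\<^sup>+x. F x * indicator A x * indicator B (x + k) \<partial>lborel)
      = (\<integral>\<^sup>+x. F (- k + x) * indicator A (- k + x) * indicator B ((- k + x) + k) \<partial>lborel)"
      by (rule nn_integral_translate[symmetric]) measurable
    also have "\<dots> = (\<integral>\<^sup>+x. F x * indicator B x * indicator A (x - k) \<partial>lborel)"
      using per[of "-k"] k by (intro nn_integral_cong) (simp add: add.commute mult_ac)
    finally show "(\<integral>\<^sup>+x. F x * indicator A x * indicator B (x + k) \<partial>lborel)
      = (\<integral>\<^sup>+x. F x * indicator B x * indicator A (x - k) \<partial>lborel)" .
  qed
  also have "\<dots> = (\<integral>\<^sup>+x. (\<integral>\<^sup>+k. F x * indicator B x * indicator A (x - k) \<partial>count_space int_lattice) \<partial>lborel)"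
    by (rule nn_integral_count_space_nn_integral[OF countable_int_lattice, symmetric]) measurable
  also have "\<dots> = (\<integral>\<^sup>+x. F x * indicator B x * (\<integral>\<^sup>+k. indicator A (x - k) \<partial>count_space int_lattice) \<partial>lborel)"
    by (simp add: nn_integral_cmult)
  also have "\<dots> = (\<integral>\<^sup>+x. F x * indicator B x \<partial>lborel)"
  proof -
    have "(\<integral>\<^sup>+k. indicator A (x - k) \<partial>count_space int_lattice) = (1::ennreal)" for x
      unfolding ind by (rule nn_integral_count_space_translates[OF A'])
    then show ?thesis by simp
  qed
  finally show ?thesis .
qed

lemma nn_integral_cube_measure:
  fixes F :: "real^'d \<Rightarrow> ennreal"
  assumes [measurable]: "F \<in> borel_measurable borel"
  shows "(\<integral>\<^sup>+x. F x \<partial>cube_measure) = (\<integral>\<^sup>+x. F x * indicator half_open_cube x \<partial>lborel)"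
proof -
  have "(\<integral>\<^sup>+x. F x \<partial>cube_measure) = (\<integral>\<^sup>+x. F x * indicator (cbox 0 1) x \<partial>lborel)"
    unfolding cube_measure_def by (subst nn_integral_restrict_space) auto
  also have "\<dots> = (\<integral>\<^sup>+x. F x * indicator half_open_cube x \<partial>lborel)"
    using AE_half_open_cube by (intro nn_integral_cong_AE) (auto simp: indicator_def)
  finally show ?thesis .
qed

text \<open>The substitution \<open>y\<close> to \<open>x - y\<close> carries the half-open cube to
  \<open>A\<close>, which is another fundamental domain. A periodic function has the same integral
  over both.\<close>

lemma nn_integral_cube_reflect:
  fixes F :: "real^'d \<Rightarrow> ennreal"
  assumes [measurable]: "F \<in> borel_measurable borel"
    and per: "\<And>x k. k \<in> int_lattice \<Longrightarrow> F (x + k) = F x"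
  shows "(\<integral>\<^sup>+y. F (x - y) \<partial>cube_measure) = (\<integral>\<^sup>+y. F y \<partial>cube_measure)"
proof -
  define A where "A = {z. x - z \<in> half_open_cube}"
  have A_borel [measurable]: "A \<in> sets borel" unfolding A_def
    using measurable_sets_borel[of "\<lambda>z. x - z" borel half_open_cube] by (simp add: vimage_def)
  have "\<exists>!k. k \<in> int_lattice \<and> z + k \<in> A" for z
  proof -
    have "k \<in> int_lattice \<and> z + k \<in> A \<longleftrightarrow> - k = frac_vec (x - z) - (x - z)" for k
      using half_open_cube_translate_unique[of "-k" "x - z"] by (simp add: A_def diff_diff_add)
    moreover have "- k = c \<longleftrightarrow> k = - c" for k c :: "real^'d" by auto
    ultimately show ?thesis by simp
  qed
  moreover have "\<exists>!k. k \<in> int_lattice \<and> z + k \<in> half_open_cube" for z :: "real^'d"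
    by (simp add: half_open_cube_translate_unique)
  ultimately have fd: "(\<integral>\<^sup>+z. F z * indicator A z \<partial>lborel) = (\<integral>\<^sup>+z. F z * indicator half_open_cube z \<partial>lborel)"
    by (intro nn_integral_fundamental_domain[OF assms(1) A_borel half_open_cube_borel per])
  have "(\<integral>\<^sup>+y. F (x - y) \<partial>cube_measure) = (\<integral>\<^sup>+y. F (x - y) * indicator half_open_cube y \<partial>lborel)"
    by (rule nn_integral_cube_measure) measurable
  also have "\<dots> = (\<integral>\<^sup>+y. F (x - y) * indicator A (x - y) \<partial>lborel)"
    by (simp add: A_def indicator_def)
  also have "\<dots> = (\<integral>\<^sup>+y. F y * indicator A y \<partial>lborel)"
    by (rule nn_integral_reflect[of "\<lambda>y. F y * indicator A y"]) measurable
  also have "\<dots> = (\<integral>\<^sup>+y. F y \<partial>cube_measure)"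
    unfolding fd by (rule nn_integral_cube_measure[symmetric]) measurable
  finally show ?thesis .
qed

text \<open>\<open>ennreal\<close> truncates negative values to 0, so the nonnegative version for
  \<open>h\<close> and \<open>- h\<close> treats the positive and the negative part.\<close>

lemma torus_integral_reflect:
  fixes h :: "real^'d \<Rightarrow> real"
  assumes [measurable]: "h \<in> borel_measurable borel" and per: "periodic h"
  shows "torus_integral (\<lambda>y. h (x - y)) = torus_integral h"
proof -
  have h: "h (y + k) = h y" if "k \<in> int_lattice" for y k
    using per that by (simp add: periodic_def)
  have p: "(\<integral>\<^sup>+y. ennreal (h (x - y)) \<partial>cube_measure) = (\<integral>\<^sup>+y. ennreal (h y) \<partial>cube_measure)"
    by (rule nn_integral_cube_reflect[of "\<lambda>y. ennreal (h y)"]) (auto simp: h)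
  have n: "(\<integral>\<^sup>+y. ennreal (- h (x - y)) \<partial>cube_measure) = (\<integral>\<^sup>+y. ennreal (- h y) \<partial>cube_measure)"
    by (rule nn_integral_cube_reflect[of "\<lambda>y. ennreal (- h y)"]) (auto simp: h)
  have i: "integrable cube_measure (\<lambda>y. h (x - y)) \<longleftrightarrow> integrable cube_measure h"
    by (simp add: real_integrable_def p n borel_measurable_cube)
  show ?thesis
  proof (cases "integrable cube_measure h")
    case True
    with i have "integrable cube_measure (\<lambda>y. h (x - y))" by simp
    with True show ?thesis
      unfolding torus_integral_eq by (simp add: real_lebesgue_integral_def p n)
  next
    \<comment> \<open>Integrals of non-integrable functions are 0 by convention, so both sides are
      0.\<close>
    case False
    with i show ?thesis by (simp add: torus_integral_eq not_integrable_integral_eq)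
  qed
qed

section \<open>Periodic and bounded Borel functions\<close>

lemma periodicD: "periodic f \<Longrightarrow> k \<in> int_lattice \<Longrightarrow> f (x + k) = f x"
  by (simp add: periodic_def)

lemma periodic_frac_vec: "periodic f \<Longrightarrow> f (frac_vec x) = f x"
  using periodicD[OF _ frac_vec_diff_lattice, of f x x] by simp

text \<open>A class wide enough for the possibly discontinuous kernel, closed under products and
  reflections, and consisting of functions integrable on the cube.\<close>

definition bounded_borel :: "('a::topological_space \<Rightarrow> real) \<Rightarrow> bool" where
  "bounded_borel f \<longleftrightarrow> f \<in> borel_measurable borel \<and> bounded (range f)"

lemma bounded_borelD [measurable_dest]: "bounded_borel f \<Longrightarrow> f \<in> borel_measurable borel"
  by (simp add: bounded_borel_def)

lemma bounded_borel_bound: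
  assumes "bounded_borel f"
  obtains B where "B \<ge> 0" "\<And>x. \<bar>f x\<bar> \<le> B"
proof -
  from assms obtain B where "\<And>x. \<bar>f x\<bar> \<le> B"
    unfolding bounded_borel_def bounded_iff by auto
  then show ?thesis using that[of B] by (meson abs_ge_zero order_trans)
qed

lemma bounded_borelI:
  "f \<in> borel_measurable borel \<Longrightarrow> (\<And>x. \<bar>f x\<bar> \<le> B) \<Longrightarrow> bounded_borel f"
  by (auto simp: bounded_borel_def bounded_iff)

lemma bounded_borel_mult:
  assumes "bounded_borel f" "bounded_borel g"
  shows "bounded_borel (\<lambda>x. f x * g x)"
proof -
  obtain B C where "\<And>x. \<bar>f x\<bar> \<le> B" "B \<ge> 0" "\<And>x. \<bar>g x\<bar> \<le> C"
    using bounded_borel_bound[OF assms(1)] bounded_borel_bound[OF assms(2)] by metis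
  then show ?thesis
    using assms by (intro bounded_borelI[of _ "B * C"]) (auto simp: abs_mult bounded_borelD intro!: mult_mono borel_measurable_times)
qed

lemma bounded_borel_compose:
  assumes "bounded_borel f" "h \<in> borel_measurable borel"
  shows "bounded_borel (\<lambda>x. f (h x))"
proof -
  obtain B where "\<And>x. \<bar>f x\<bar> \<le> B"
    using bounded_borel_bound[OF assms(1)] by metis
  then show ?thesis
    using measurable_compose[OF assms(2) bounded_borelD[OF assms(1)]]
    by (intro bounded_borelI[of _ B]) auto
qed

lemma bounded_borel_reflect:
  fixes f :: "'a::euclidean_space \<Rightarrow> real"
  shows "bounded_borel f \<Longrightarrow> bounded_borel (\<lambda>y. f (x - y))"
  by (rule bounded_borel_compose) auto

lemma bounded_borel_const [simp]: "bounded_borel (\<lambda>_. c)"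
  by (rule bounded_borelI[of _ "\<bar>c\<bar>"]) auto

lemma bounded_borel_integrable:
  "bounded_borel f \<Longrightarrow> integrable cube_measure f"
  by (metis bounded_borel_bound bounded_borelD borel_measurable_cube cube.integrable_const_bound AE_I2 real_norm_def)

text \<open>Periodicity makes all values occur on the compact cube.\<close>

lemma bounded_borel_continuous_periodic:
  fixes f :: "real^'d \<Rightarrow> real"
  assumes c: "continuous_on UNIV f" and p: "periodic f"
  shows "bounded_borel f"
proof -
  have "bounded (f ` cbox 0 1)"
    by (intro compact_imp_bounded compact_continuous_image continuous_on_subset[OF c]) auto
  moreover have "range f \<subseteq> f ` cbox 0 1"
    using periodic_frac_vec[OF p] frac_vec_in_cbox by (metis image_eqI image_subsetI)
  ultimately show ?thesis
    using c by (auto simp: bounded_borel_def borel_measurable_continuous_onI intro: bounded_subset)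
qed

text \<open>Reflection moves \<open>x\<close> from the kernel to \<open>f\<close>, so that
  differentiation in \<open>x\<close> falls on the smooth factor.\<close>

lemma torus_conv_flip:
  fixes K f :: "real^'d \<Rightarrow> real"
  assumes K: "bounded_borel K" "periodic K" and f: "bounded_borel f" "periodic f"
  shows "torus_conv K f x = torus_integral (\<lambda>y. K y * f (x - y))"
proof -
  have "bounded_borel (\<lambda>y. K (x - y) * f y)"
    by (intro bounded_borel_mult bounded_borel_reflect K f)
  moreover have "periodic (\<lambda>y. K (x - y) * f y)"
    using periodicD[OF K(2), of "-_"] periodicD[OF f(2)]
    by (auto simp: periodic_def) (metis add_uminus_conv_diff diff_diff_add uminus_int_lattice)
  ultimately have "torus_integral (\<lambda>y. K (x - (x - y)) * f (x - y)) = torus_integral (\<lambda>y. K (x - y) * f y)"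
    by (intro torus_integral_reflect[of "\<lambda>y. K (x - y) * f y"]) (auto simp: bounded_borelD)
  then show ?thesis by (simp add: torus_conv_def)
qed

subsection \<open>Smoothness of convolutions\<close>

lemma periodic_torus_conv:
  assumes "periodic K" shows "periodic (torus_conv K f)"
proof -
  have "K (x + k - y) = K (x - y)" if "k \<in> int_lattice" for x y k
    using periodicD[OF assms that, of "x - y"] by (simp add: algebra_simps)
  then show ?thesis by (simp add: periodic_def torus_conv_def)
qed

text \<open>\<open>partial_deriv\<close> is the \<open>deriv\<close> of a restriction to a line,
  hence meaningful only once a derivative exists; the chain rule along the line supplies it.\<close>

lemma partial_deriv_eq:
  fixes f :: "real^'d \<Rightarrow> real"
  assumes "(f has_derivative D) (at x)"
  shows "partial_deriv i f x = D (axis i 1)"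
proof -
  have "((\<lambda>t. x + t *\<^sub>R axis i 1) has_derivative (\<lambda>t. t *\<^sub>R axis i 1)) (at 0)"
    by (auto intro!: derivative_eq_intros)
  then have "((\<lambda>t. f (x + t *\<^sub>R axis i 1)) has_derivative (\<lambda>t. D (t *\<^sub>R axis i 1))) (at 0)"
    by (rule has_derivative_compose) (use assms in simp)
  moreover have "(\<lambda>t. D (t *\<^sub>R axis i 1)) = (*) (D (axis i 1))"
    using has_derivative_bounded_linear[OF assms] by (auto simp: linear_simps)
  ultimately have "((\<lambda>t. f (x + t *\<^sub>R axis i 1)) has_field_derivative D (axis i 1)) (at 0)"
    by (simp add: has_field_derivative_def)
  then show ?thesis unfolding partial_deriv_def by (rule DERIV_imp_deriv)
qed

lemma has_derivative_partials:
  fixes f :: "real^'d \<Rightarrow> real"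
  assumes "f differentiable at x"
  shows "(f has_derivative (\<lambda>h. \<Sum>i\<in>UNIV. h $ i * partial_deriv i f x)) (at x)"
proof -
  obtain D where D: "(f has_derivative D) (at x)" using assms by (auto simp: differentiable_def)
  interpret bounded_linear D using D by (rule has_derivative_bounded_linear)
  have "D h = (\<Sum>i\<in>UNIV. h $ i * partial_deriv i f x)" for h
  proof -
    have "D h = D (\<Sum>i\<in>UNIV. h $ i *s axis i 1)" by (simp add: basis_expansion)
    also have "\<dots> = (\<Sum>i\<in>UNIV. h $ i * D (axis i 1))"
      by (simp add: sum scalar_mult_eq_scaleR scaleR)
    finally show ?thesis by (simp add: partial_deriv_eq[OF D])
  qed
  then have "D = (\<lambda>h. \<Sum>i\<in>UNIV. h $ i * partial_deriv i f x)" by auto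
  then show ?thesis using D by simp
qed

lemma periodic_partial_deriv:
  assumes "periodic f"
  shows "periodic (partial_deriv i f)"
proof -
  have "f (x + k + v) = f (x + v)" if "k \<in> int_lattice" for x k v
    using periodicD[OF assms that, of "x + v"] by (simp add: add.commute add.left_commute)
  then show ?thesis by (simp add: periodic_def partial_deriv_def)
qed

lemma Ck_SucD: "Ck (Suc k) f \<Longrightarrow> f differentiable at x" "Ck (Suc k) f \<Longrightarrow> Ck k (partial_deriv i f)"
  by (auto simp: differentiable_on_def)

lemma Ck_continuous: "Ck k f \<Longrightarrow> continuous_on UNIV f"
  by (cases k) (auto simp: differentiable_imp_continuous_on)

lemma Ck_Suc_imp: "Ck (Suc k) f \<Longrightarrow> Ck k f"
  by (induction k arbitrary: f) (auto simp: differentiable_imp_continuous_on)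

lemma sum_component_mult_le:
  fixes h :: "real^'d"
  assumes "\<And>i. \<bar>c i\<bar> \<le> B i"
  shows "\<bar>\<Sum>i\<in>UNIV. h $ i * c i\<bar> \<le> (\<Sum>i\<in>UNIV. B i) * norm h"
proof -
  have "\<bar>\<Sum>i\<in>UNIV. h $ i * c i\<bar> \<le> (\<Sum>i\<in>UNIV. \<bar>h $ i * c i\<bar>)" by (rule sum_abs)
  also have "\<dots> \<le> (\<Sum>i\<in>UNIV. norm h * B i)"
    using assms component_le_norm_cart[of h] unfolding abs_mult by (intro sum_mono mult_mono) auto
  finally show ?thesis by (simp add: sum_distrib_left mult.commute)
qed

text \<open>Differentiation under the integral by dominated convergence. The partials of
  \<open>f\<close> are continuous and periodic, hence bounded, so \<open>f\<close> is Lipschitz and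
  its first-order remainders are bounded uniformly.\<close>

lemma torus_conv_has_derivative:
  fixes K f :: "real^'d \<Rightarrow> real"
  assumes K: "bounded_borel K" "periodic K" and f: "periodic f" "Ck 1 f"
  shows "(torus_conv K f has_derivative
    (\<lambda>h. \<Sum>i\<in>UNIV. h $ i * torus_conv K (partial_deriv i f) x)) (at x)"
proof -
  define p where "p = (\<lambda>i. partial_deriv i f)"
  have bf: "bounded_borel f"
    using f Ck_continuous by (intro bounded_borel_continuous_periodic)
  have bp: "bounded_borel (p i)" "periodic (p i)" for i
    using f by (auto simp: p_def periodic_partial_deriv intro!: bounded_borel_continuous_periodic)
  have D: "(f has_derivative (\<lambda>h. \<Sum>i\<in>UNIV. h $ i * p i z)) (at z)" for z
    unfolding p_def using f by (intro has_derivative_partials) (auto simp: differentiable_on_def)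
  obtain B where B: "\<And>i z. \<bar>p i z\<bar> \<le> B i"
  proof -
    have "\<exists>B. \<forall>z. \<bar>p i z\<bar> \<le> B" for i
      using bounded_borel_bound[OF bp(1)[of i]] by metis
    then show ?thesis using that by metis
  qed
  obtain C where C: "\<And>y. \<bar>K y\<bar> \<le> C" "C \<ge> 0" using bounded_borel_bound[OF K(1)] by metis
  define L where "L = (\<Sum>i\<in>UNIV. B i)"
  have lin: "\<bar>\<Sum>i\<in>UNIV. h $ i * p i z\<bar> \<le> L * norm h" for h :: "real^'d" and z
    unfolding L_def by (rule sum_component_mult_le) (rule B)
  \<comment> \<open>Mean value inequality: \<open>L\<close> bounds the operator norm of every
    derivative of \<open>f\<close>.\<close>
  have lip: "\<bar>f a - f b\<bar> \<le> L * norm (a - b)" for a b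
  proof -
    have "norm (f a - f b) \<le> L * norm (a - b)"
      by (rule differentiable_bound[of UNIV, OF _ D]) (auto intro!: onorm_le lin)
    then show ?thesis by simp
  qed
  \<comment> \<open>The normalized first-order remainder of \<open>f\<close> at
    \<open>x - y\<close>; the increment from \<open>x - y\<close> to \<open>z - y\<close> is
    \<open>z - x\<close>, independent of \<open>y\<close>.\<close>
  define r where "r = (\<lambda>z y. (f (z - y) - f (x - y) - (\<Sum>i\<in>UNIV. (z - x) $ i * p i (x - y))) / norm (z - x))"
  have bm [measurable]: "f \<in> borel_measurable borel" "K \<in> borel_measurable borel" "p i \<in> borel_measurable borel" for i
    using bf K bp by (auto simp: bounded_borelD)
  have rb: "\<bar>r z y\<bar> \<le> 2 * L" if "z \<noteq> x" for z y
  proof -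
    have "\<bar>f (z - y) - f (x - y) - (\<Sum>i\<in>UNIV. (z - x) $ i * p i (x - y))\<bar> \<le> L * norm (z - x) + L * norm (z - x)"
      using lip[of "z - y" "x - y"] lin[of "z - x" "x - y"] by simp
    then show ?thesis using that by (simp add: r_def abs_divide divide_le_eq)
  qed
  \<comment> \<open>Integrating the remainder of \<open>f\<close> against \<open>K\<close> gives the
    remainder of the convolution, so it suffices to show that this integral tends to 0.\<close>
  have T: "torus_integral (\<lambda>y. K y * r z y)
      = (torus_conv K f z - torus_conv K f x - (\<Sum>i\<in>UNIV. (z - x) $ i * torus_conv K (p i) x)) / norm (z - x)" for z
  proof -
    have I: "integrable cube_measure (\<lambda>y. K y * g (u - y))" if "bounded_borel g" for g and u
      by (intro bounded_borel_integrable bounded_borel_mult bounded_borel_reflect K that)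
    have "K y * r z y = (K y * f (z - y) - K y * f (x - y) - (\<Sum>i\<in>UNIV. (z - x) $ i * (K y * p i (x - y)))) / norm (z - x)" for y
      by (simp add: r_def algebra_simps sum_distrib_left)
    then have "torus_integral (\<lambda>y. K y * r z y) =
      (torus_integral (\<lambda>y. K y * f (z - y)) - torus_integral (\<lambda>y. K y * f (x - y))
       - (\<Sum>i\<in>UNIV. (z - x) $ i * torus_integral (\<lambda>y. K y * p i (x - y)))) / norm (z - x)"
      unfolding torus_integral_eq using I[OF bf] I[OF bp(1)]
      by (simp add: Bochner_Integration.integral_diff Bochner_Integration.integral_sum)
    then show ?thesis using K bf f bp by (simp add: torus_conv_flip)
  qed
  \<comment> \<open>Dominated convergence concerns sequences, so the limit is tested along sequences
    that avoid \<open>x\<close>, where \<open>rb\<close> provides the dominating constant.\<close>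
  have "((\<lambda>z. torus_integral (\<lambda>y. K y * r z y)) \<longlongrightarrow> 0) (at x)"
    unfolding tendsto_at_iff_sequentially comp_def
  proof (intro allI impI)
    fix X :: "nat \<Rightarrow> real^'d" assume X: "\<forall>n. X n \<in> UNIV - {x}" "X \<longlonglongrightarrow> x"
    have "(\<lambda>n. integral\<^sup>L cube_measure (\<lambda>y. K y * r (X n) y)) \<longlonglongrightarrow> integral\<^sup>L cube_measure (\<lambda>y::real^'d. 0)"
    proof (rule integral_dominated_convergence[where w = "\<lambda>_. C * (2 * L)"])
      show "(\<lambda>y. K y * r (X n) y) \<in> borel_measurable cube_measure" for n
        unfolding r_def by (rule borel_measurable_cube) measurable
      show "AE y in cube_measure. norm (K y * r (X n) y) \<le> C * (2 * L)" for n
        using X rb C by (auto simp: abs_mult intro!: mult_mono)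
      show "AE y in cube_measure. (\<lambda>n. K y * r (X n) y) \<longlonglongrightarrow> 0"
      proof (rule AE_I2)
        fix y
        have "((\<lambda>w. (f w - f (x - y) - (\<Sum>i\<in>UNIV. (w - (x - y)) $ i * p i (x - y))) / norm (w - (x - y))) \<longlongrightarrow> 0) (at (x - y))"
          by (rule tendsto_norm_zero_cancel) (use D[of "x - y"] in \<open>simp add: has_derivative_iff_norm norm_divide\<close>)
        then have "(\<lambda>n. (f (X n - y) - f (x - y) - (\<Sum>i\<in>UNIV. (X n - y - (x - y)) $ i * p i (x - y))) / norm (X n - y - (x - y))) \<longlonglongrightarrow> 0"
          unfolding tendsto_at_iff_sequentially comp_def using X
          by (elim allE[of _ "\<lambda>n. X n - y"]) (auto intro!: tendsto_intros)
        then have "(\<lambda>n. r (X n) y) \<longlonglongrightarrow> 0" by (simp add: r_def)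
        then show "(\<lambda>n. K y * r (X n) y) \<longlonglongrightarrow> 0" by (rule tendsto_mult_right_zero)
      qed
    qed auto
    then show "(\<lambda>n. torus_integral (\<lambda>y. K y * r (X n) y)) \<longlonglongrightarrow> 0"
      by (simp add: torus_integral_eq)
  qed
  then have "((\<lambda>z. norm (torus_integral (\<lambda>y. K y * r z y))) \<longlongrightarrow> 0) (at x)"
    by (rule tendsto_norm_zero)
  moreover have "bounded_linear (\<lambda>h::real^'d. \<Sum>i\<in>UNIV. h $ i * torus_conv K (p i) x)"
    by (intro bounded_linear_sum bounded_linear_mult_left[THEN bounded_linear_compose] bounded_linear_vec_nth)
  ultimately show ?thesis
    unfolding has_derivative_iff_norm T by (simp add: p_def norm_divide)
qed

lemma partial_deriv_torus_conv:
  fixes K f :: "real^'d \<Rightarrow> real"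
  assumes "bounded_borel K" "periodic K" "periodic f" "Ck 1 f"
  shows "partial_deriv i (torus_conv K f) = torus_conv K (partial_deriv i f)"
proof
  fix x
  show "partial_deriv i (torus_conv K f) x = torus_conv K (partial_deriv i f) x"
    unfolding partial_deriv_eq[OF torus_conv_has_derivative[OF assms]]
    by (simp add: axis_def if_distrib[of "\<lambda>u. u * _"] cong: if_cong)
qed

text \<open>Convolution with \<open>1\<close> is constant, but its derivative is the integral of the derivative.\<close>

lemma torus_integral_partial_deriv:
  fixes f :: "real^'d \<Rightarrow> real"
  assumes "periodic f" "Ck 1 f"
  shows "torus_integral (partial_deriv i f) = 0"
proof -
  have c: "torus_conv (\<lambda>_. 1) g = (\<lambda>_. torus_integral g)" for g :: "real^'d \<Rightarrow> real"
    by (simp add: torus_conv_def fun_eq_iff)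
  have "partial_deriv i (torus_conv (\<lambda>_. 1) f) = torus_conv (\<lambda>_. 1) (partial_deriv i f)"
    by (rule partial_deriv_torus_conv) (use assms in \<open>auto simp: periodic_def\<close>)
  then have "torus_integral (partial_deriv i f) = partial_deriv i (\<lambda>_. torus_integral f) 0"
    using fun_cong[of _ _ 0] by (simp add: c)
  also have "\<dots> = 0" by (simp add: partial_deriv_def)
  finally show ?thesis .
qed

text \<open>One order is given up because differentiability of the convolution was derived from
  \<open>Ck 1 f\<close>; for smooth \<open>f\<close> this costs nothing. The induction varies
  \<open>f\<close> since partial derivatives pass onto it.\<close>

lemma Ck_torus_conv:
  fixes K f :: "real^'d \<Rightarrow> real"
  assumes "bounded_borel K" "periodic K" "periodic f" "Ck (Suc k) f"
  shows "Ck k (torus_conv K f)"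
  using assms(3,4)
proof (induction k arbitrary: f)
  case 0
  then have "(torus_conv K f has_derivative
    (\<lambda>h. \<Sum>i\<in>UNIV. h $ i * torus_conv K (partial_deriv i f) x)) (at x)" for x
    using assms by (intro torus_conv_has_derivative) auto
  then have "torus_conv K f differentiable_on UNIV"
    by (auto simp: differentiable_on_def differentiable_def)
  then show ?case by (simp add: differentiable_imp_continuous_on)
next
  case (Suc k)
  have c1: "Ck 1 f"
    using Suc.prems(2) unfolding One_nat_def Ck.simps(2)[of _ f] Ck.simps(1)
    by (blast intro: Ck_continuous)
  then have "(torus_conv K f has_derivative
    (\<lambda>h. \<Sum>i\<in>UNIV. h $ i * torus_conv K (partial_deriv i f) x)) (at x)" for x
    using assms Suc.prems by (intro torus_conv_has_derivative) auto
  then have "torus_conv K f differentiable_on UNIV"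
    by (auto simp: differentiable_on_def differentiable_def)
  moreover have "Ck k (partial_deriv i (torus_conv K f))" for i
    unfolding partial_deriv_torus_conv[OF assms(1,2) Suc.prems(1) c1]
    by (rule Suc.IH) (use Suc.prems in \<open>auto intro: periodic_partial_deriv\<close>)
  ultimately show ?case by simp
qed

lemma smooth_torus_conv:
  fixes K f :: "real^'d \<Rightarrow> real"
  assumes "bounded_borel K" "periodic K" "periodic f" "smooth f"
  shows "smooth (torus_conv K f)"
  using assms Ck_torus_conv unfolding smooth_def by blast

subsection \<open>Smooth functions\<close>

lemma sum_axis_mult [simp]: "(\<Sum>j\<in>UNIV. axis i (1::real) $ j * c j) = c i"
  by (simp add: axis_def if_distrib[of "\<lambda>u. u * _"] cong: if_cong)

lemma partial_deriv_add:
  fixes f g :: "real^'d \<Rightarrow> real"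
  assumes "f differentiable at x" "g differentiable at x"
  shows "partial_deriv i (\<lambda>x. f x + g x) x = partial_deriv i f x + partial_deriv i g x"
  using partial_deriv_eq[OF has_derivative_add[OF assms[THEN has_derivative_partials]]] by simp

lemma partial_deriv_mult:
  fixes f g :: "real^'d \<Rightarrow> real"
  assumes "f differentiable at x" "g differentiable at x"
  shows "partial_deriv i (\<lambda>x. f x * g x) x = f x * partial_deriv i g x + partial_deriv i f x * g x"
  using partial_deriv_eq[OF has_derivative_mult[OF assms[THEN has_derivative_partials]]] by simp

lemma partial_deriv_compose:
  fixes f :: "real^'d \<Rightarrow> real"
  assumes "(\<phi> has_real_derivative d) (at (f x))" "f differentiable at x"
  shows "partial_deriv i (\<lambda>x. \<phi> (f x)) x = d * partial_deriv i f x"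
  using partial_deriv_eq[OF has_derivative_compose[OF has_derivative_partials[OF assms(2)]
    assms(1)[unfolded has_field_derivative_def]]] by simp

lemma partial_deriv_const: "partial_deriv i (\<lambda>_. c) = (\<lambda>_. 0)"
  by (simp add: partial_deriv_def fun_eq_iff)

lemma Ck_const: "Ck k (\<lambda>_. c)"
  by (induction k arbitrary: c) (auto simp: partial_deriv_const)

lemma Ck_add: "Ck k f \<Longrightarrow> Ck k g \<Longrightarrow> Ck k (\<lambda>x. f x + g x)"
proof (induction k arbitrary: f g)
  case (Suc k)
  have "partial_deriv i (\<lambda>x. f x + g x) = (\<lambda>x. partial_deriv i f x + partial_deriv i g x)" for i
    using Suc.prems by (intro ext partial_deriv_add) (auto simp: differentiable_on_def)
  with Suc show ?case by auto
qed (auto intro: continuous_intros)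

lemma Ck_mult: "Ck k f \<Longrightarrow> Ck k g \<Longrightarrow> Ck k (\<lambda>x. f x * g x)"
proof (induction k arbitrary: f g)
  case (Suc k)
  have "partial_deriv i (\<lambda>x. f x * g x) = (\<lambda>x. f x * partial_deriv i g x + partial_deriv i f x * g x)" for i
    using Suc.prems by (intro ext partial_deriv_mult) (auto simp: differentiable_on_def)
  moreover have "Ck k f" "Ck k g" using Suc.prems Ck_Suc_imp by blast+
  ultimately show ?case using Suc by (auto intro!: Ck_add)
qed (auto intro: continuous_intros)

text \<open>The derivative contains \<open>exp (f x)\<close> again as a factor, whose regularity at
  the lower order is the induction hypothesis.\<close>

lemma Ck_exp: "Ck k f \<Longrightarrow> Ck k (\<lambda>x. exp (f x))"
proof (induction k)
  case (Suc k)
  have d: "f differentiable at x" for x using Suc.prems by (auto simp: differentiable_on_def)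
  then have "partial_deriv i (\<lambda>x. exp (f x)) = (\<lambda>x. exp (f x) * partial_deriv i f x)" for i
    by (intro ext partial_deriv_compose) (auto intro!: DERIV_exp)
  moreover have "(\<lambda>x. exp (f x)) differentiable at x" for x
    using has_derivative_exp[OF has_derivative_partials[OF d]] by (auto simp: differentiable_def)
  moreover have "Ck k (\<lambda>x. exp (f x))" using Suc Ck_Suc_imp by blast
  ultimately show ?case using Suc.prems by (auto simp: differentiable_on_def intro!: Ck_mult)
qed (auto intro: continuous_intros)

lemma Ck_inverse: "Ck k f \<Longrightarrow> (\<And>x. f x \<noteq> 0) \<Longrightarrow> Ck k (\<lambda>x. inverse (f x))"
proof (induction k)
  case (Suc k)
  have d: "f differentiable at x" for x using Suc.prems by (auto simp: differentiable_on_def)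
  then have "partial_deriv i (\<lambda>x. inverse (f x)) = (\<lambda>x. - 1 * (inverse (f x) * inverse (f x)) * partial_deriv i f x)" for i
    using Suc.prems(2) by (intro ext partial_deriv_compose) (auto intro!: derivative_eq_intros)
  moreover have "(\<lambda>x. inverse (f x)) differentiable at x" for x
    using Suc.prems(2) d by (intro differentiable_inverse) auto
  moreover have "Ck k (\<lambda>x. - 1 * (inverse (f x) * inverse (f x)) * partial_deriv i f x)" for i
    using Suc Ck_Suc_imp[OF Suc.prems(1)] by (intro Ck_mult Ck_const) auto
  ultimately show ?case by (simp add: differentiable_on_def)
qed (auto intro: continuous_intros)

text \<open>The derivative involves only the reciprocal of \<open>f\<close>, so a case distinction
  and \<open>Ck_inverse\<close> one order lower replace an induction.\<close>

lemma Ck_ln: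
  assumes "Ck k f" "\<And>x. f x > 0"
  shows "Ck k (\<lambda>x. ln (f x))"
proof (cases k)
  case 0
  with assms show ?thesis by (auto intro!: continuous_intros simp: less_imp_neq[symmetric])
next
  case (Suc l)
  have d: "f differentiable at x" for x using assms Suc by (auto simp: differentiable_on_def)
  then have "partial_deriv i (\<lambda>x. ln (f x)) = (\<lambda>x. inverse (f x) * partial_deriv i f x)" for i
    using assms(2) by (intro ext partial_deriv_compose) (auto intro!: derivative_eq_intros simp: divide_inverse)
  moreover have "(\<lambda>x. ln (f x)) differentiable at x" for x
    using has_derivative_ln[OF assms(2) has_derivative_partials[OF d]] by (auto simp: differentiable_def)
  moreover have "Ck l (\<lambda>x. inverse (f x))"
    using assms Suc Ck_Suc_imp by (intro Ck_inverse) (auto simp: less_imp_neq[symmetric])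
  ultimately show ?thesis using assms Suc by (auto simp: differentiable_on_def intro!: Ck_mult)
qed

subsection \<open>Interaction kernels and the free energy\<close>

lemma borel_measurable_frac_vec: "frac_vec \<in> borel_measurable borel"
proof (rule borel_measurable_euclidean_space[THEN iffD2], rule ballI)
  fix b :: "real^'d" assume "b \<in> Basis"
  then obtain i where b: "b = axis i 1" by (auto simp: Basis_vec_def)
  have [measurable]: "(\<lambda>x::real^'d. x $ i) \<in> borel_measurable borel"
    by (intro borel_measurable_continuous_onI continuous_intros)
  have "(\<lambda>x::real^'d. frac (x $ i)) \<in> borel_measurable borel"
    unfolding frac_def by measurable
  then show "(\<lambda>x::real^'d. frac_vec x \<bullet> b) \<in> borel_measurable borel"
    by (simp add: b inner_axis frac_vec_def)
qed

text \<open>The integral of \<open>W\<close> is 1, while a non-integrable function would have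
  integral 0. So \<open>W\<close> is integrable, hence measurable, on the cube, and composition with
  \<open>frac_vec\<close> extends this to the whole space.\<close>

lemma interaction_kernel_bounded_borel:
  fixes W :: "real^'d \<Rightarrow> real"
  assumes "interaction_kernel W"
  shows "bounded_borel W"
proof -
  have p: "periodic W" and b: "bounded (range W)" and "torus_integral W = 1"
    using assms unfolding interaction_kernel_def by blast+
  then have "integrable lborel (\<lambda>x. indicator (cbox 0 1) x *\<^sub>R W x)"
    using not_integrable_integral_eq unfolding torus_integral_def set_lebesgue_integral_def
    by (metis zero_neq_one)
  then have "(\<lambda>x. indicator (cbox 0 1) x *\<^sub>R W x) \<in> borel_measurable borel"
    by (simp add: borel_measurable_integrable)
  then have "(\<lambda>x. indicator (cbox 0 1) (frac_vec x) *\<^sub>R W (frac_vec x)) \<in> borel_measurable borel"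
    by (rule measurable_compose[OF borel_measurable_frac_vec])
  then have "W \<in> borel_measurable borel"
    by (simp add: frac_vec_in_cbox periodic_frac_vec[OF p])
  then show ?thesis using b by (simp add: bounded_borel_def)
qed

section \<open>Evenness of the kernel and symmetry of the interaction energy\<close>

lemma torus_norm_uminus:
  fixes x :: "real^'d"
  shows "torus_norm (- x) = torus_norm x"
proof -
  have "uminus ` (int_lattice :: (real^'d) set) = int_lattice"
    by (auto simp: image_iff) (metis add.inverse_inverse uminus_int_lattice)
  moreover have "dist (- x) ` (uminus ` int_lattice) = dist x ` (int_lattice :: (real^'d) set)"
    by (simp add: image_image dist_norm norm_minus_commute)
  ultimately show ?thesis by (simp add: torus_norm_def infdist_def)
qed

text \<open>The lattice is symmetric, so opposite points have the same \<open>torus_norm\<close>,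
  and \<open>W\<close> depends on this norm only.\<close>

lemma interaction_kernel_even: "interaction_kernel W \<Longrightarrow> W (x - y) = W (y - x)"
  using torus_norm_uminus[of "x - y"] unfolding interaction_kernel_def
  by (metis minus_diff_eq)

text \<open>Fubini and evenness of \<open>K\<close>; the integrand is bounded on a finite product
  measure and so integrable.\<close>

lemma torus_integral_conv_symmetric:
  fixes K f g :: "real^'d \<Rightarrow> real"
  assumes K: "bounded_borel K" "\<And>x y. K (x - y) = K (y - x)" and "bounded_borel f" "bounded_borel g"
  shows "torus_integral (\<lambda>x. f x * torus_conv K g x) = torus_integral (\<lambda>x. g x * torus_conv K f x)"
proof -
  let ?N = "cube_measure :: (real^'d) measure"
  interpret P: pair_sigma_finite ?N ?N ..
  interpret PF: finite_measure "?N \<Otimes>\<^sub>M ?N"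
    by (intro finite_measure_pair_measure cube.finite_measure_axioms)
  \<comment> \<open>The factors carry restricted sigma-algebras; through the identity the
    projections become measurable into \<open>borel\<close>.\<close>
  have id: "(\<lambda>x. x) \<in> borel_measurable ?N" by (rule borel_measurable_cube) simp
  have [measurable]: "fst \<in> borel_measurable (?N \<Otimes>\<^sub>M ?N)" "snd \<in> borel_measurable (?N \<Otimes>\<^sub>M ?N)"
    by (rule measurable_compose[OF measurable_fst id] measurable_compose[OF measurable_snd id])+
  have [measurable]: "f \<in> borel_measurable borel" "g \<in> borel_measurable borel" "K \<in> borel_measurable borel"
    using assms by (auto simp: bounded_borelD)
  obtain A B C where b: "\<And>x. \<bar>f x\<bar> \<le> A" "A \<ge> 0" "\<And>x. \<bar>g x\<bar> \<le> B" "B \<ge> 0" "\<And>x. \<bar>K x\<bar> \<le> C" "C \<ge> 0"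
    using bounded_borel_bound assms(1,3,4) by metis
  have "integrable (?N \<Otimes>\<^sub>M ?N) (\<lambda>z. f (fst z) * (K (fst z - snd z) * g (snd z)))"
  proof (rule PF.integrable_const_bound[where B = "A * (C * B)"])
    show "AE z in ?N \<Otimes>\<^sub>M ?N. norm (f (fst z) * (K (fst z - snd z) * g (snd z))) \<le> A * (C * B)"
      using b by (auto simp: abs_mult intro!: mult_mono)
  qed measurable
  then have i: "integrable (?N \<Otimes>\<^sub>M ?N) (case_prod (\<lambda>x y. f x * (K (x - y) * g y)))"
    by (simp add: split_beta')
  have "torus_integral (\<lambda>x. f x * torus_conv K g x)
      = (LINT x|?N. LINT y|?N. f x * (K (x - y) * g y))"
    by (simp add: torus_conv_def torus_integral_eq)
  also have "\<dots> = (LINT y|?N. LINT x|?N. f x * (K (x - y) * g y))"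
    by (rule P.Fubini_integral[OF i, symmetric])
  also have "\<dots> = (LINT y|?N. LINT x|?N. g y * (K (y - x) * f x))"
  proof (intro Bochner_Integration.integral_cong refl)
    show "f x * (K (x - y) * g y) = g y * (K (y - x) * f x)" for x y
      using K(2)[of x y] by simp
  qed
  also have "\<dots> = torus_integral (\<lambda>x. g x * torus_conv K f x)"
    by (simp add: torus_conv_def torus_integral_eq)
  finally show ?thesis .
qed

section \<open>Continuous integrands and the first variation of the free energy\<close>

lemma torus_integral_continuous:
  assumes "continuous_on (cbox 0 1) f"
  shows "f integrable_on cbox 0 1" "torus_integral f = integral (cbox 0 1) f"
proof -
  have "set_integrable lborel (cbox 0 1) f"
    unfolding set_integrable_def using assms by (intro borel_integrable_compact) auto
  then show "f integrable_on cbox 0 1" "torus_integral f = integral (cbox 0 1) f"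
    unfolding torus_integral_def by (simp_all add: set_borel_integral_eq_integral)
qed

text \<open>On the cube this is the vanishing of a continuous nonnegative function with zero
  integral; \<open>frac_vec\<close> brings every other point there.\<close>

lemma torus_integral_eq_0_imp:
  fixes f :: "real^'d \<Rightarrow> real"
  assumes c: "continuous_on UNIV f" and p: "periodic f" and nn: "\<And>x. 0 \<le> f x" and "torus_integral f = 0"
  shows "f x = 0"
proof -
  have c': "continuous_on (cbox 0 1) f" using c continuous_on_subset by blast
  have "(f has_integral 0) (cbox 0 1)"
    using torus_integral_continuous[OF c'] assms(4) by (simp add: has_integral_integral)
  then have "f (frac_vec x) = 0"
    by (rule has_integral_0_cbox_imp_0[OF c' nn]) (auto simp: frac_vec_in_cbox interval_ne_empty_cart)
  then show ?thesis by (simp add: periodic_frac_vec[OF p])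
qed

text \<open>Differentiation under the integral sign: \<open>s * (ln s - 1)\<close> has derivative
  \<open>ln s\<close>.\<close>

lemma entropy_has_derivative:
  fixes \<rho> \<eta> :: "real^'d \<Rightarrow> real"
  assumes r: "continuous_on UNIV \<rho>" "\<And>x. \<rho> x > 0" and e: "continuous_on UNIV \<eta>"
  shows "((\<lambda>\<epsilon>. torus_integral (\<lambda>x. (\<rho> x + \<epsilon> * \<eta> x) * (ln (\<rho> x + \<epsilon> * \<eta> x) - 1)))
    has_real_derivative torus_integral (\<lambda>x. \<eta> x * ln (\<rho> x))) (at 0)"
proof -
  let ?Q = "cbox 0 1 :: (real^'d) set"
  have rc: "continuous_on ?Q \<rho>" and ec: "continuous_on ?Q \<eta>"
    using r e continuous_on_subset by blast+
  obtain a where a: "\<And>y. y \<in> ?Q \<Longrightarrow> \<rho> a \<le> \<rho> y"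
    using continuous_attains_inf[OF compact_cbox _ rc] by auto
  have "bounded (\<eta> ` ?Q)"
    by (intro compact_imp_bounded compact_continuous_image ec compact_cbox)
  then obtain E where E: "E > 0" "\<And>y. y \<in> ?Q \<Longrightarrow> \<bar>\<eta> y\<bar> \<le> E"
    by (auto simp: bounded_pos)
  \<comment> \<open>The minimum of \<open>\<rho>\<close> over a bound for \<open>\<eta>\<close> on
    the cube: for smaller parameters the perturbed density stays positive, inside the domain where
    \<open>ln\<close> is differentiable.\<close>
  define \<delta> where "\<delta> = \<rho> a / E"
  have d: "\<delta> > 0" using E r by (simp add: \<delta>_def)
  have pos: "\<rho> y + t * \<eta> y > 0" if "t \<in> ball 0 \<delta>" "y \<in> ?Q" for t y
  proof -
    have "\<bar>t * \<eta> y\<bar> \<le> \<bar>t\<bar> * E" using E that by (auto simp: abs_mult intro!: mult_left_mono)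
    also have "\<dots> < \<rho> a" using that E by (simp add: \<delta>_def pos_less_divide_eq)
    finally show ?thesis using a[OF that(2)] by linarith
  qed
  let ?f = "\<lambda>t x. (\<rho> x + t * \<eta> x) * (ln (\<rho> x + t * \<eta> x) - 1)"
  have cf: "continuous_on ?Q (?f t)" if "t \<in> ball 0 \<delta>" for t
    using pos[OF that] by (intro continuous_intros rc ec) (auto simp: less_imp_neq[symmetric])
  have "((\<lambda>t. integral ?Q (?f t)) has_field_derivative integral ?Q (\<lambda>x. \<eta> x * ln (\<rho> x + 0 * \<eta> x))) (at 0 within ball 0 \<delta>)"
  proof (rule leibniz_rule_field_derivative[where fx = "\<lambda>t x. \<eta> x * ln (\<rho> x + t * \<eta> x)"])
    show "((\<lambda>t. ?f t x) has_field_derivative \<eta> x * ln (\<rho> x + t * \<eta> x)) (at t within ball 0 \<delta>)"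
      if "t \<in> ball 0 \<delta>" "x \<in> ?Q" for t x
    proof -
      have "((\<lambda>s. s * (ln s - 1)) has_field_derivative ln s) (at s)" if "s > 0" for s :: real
        using that by (auto intro!: derivative_eq_intros)
      moreover have "((\<lambda>t. \<rho> x + t * \<eta> x) has_field_derivative \<eta> x) (at t within ball 0 \<delta>)"
        by (auto intro!: derivative_eq_intros)
      ultimately have "((\<lambda>t. ?f t x) has_field_derivative ln (\<rho> x + t * \<eta> x) * \<eta> x) (at t within ball 0 \<delta>)"
        using pos[OF that]
        by (intro DERIV_chain2[where f = "\<lambda>s. s * (ln s - 1)" and g = "\<lambda>t. \<rho> x + t * \<eta> x"])
      then show ?thesis by (simp add: mult.commute)
    qed
    show "?f t integrable_on ?Q" if "t \<in> ball 0 \<delta>" for t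
      by (rule torus_integral_continuous(1)[OF cf[OF that]])
    have c1: "continuous_on (ball 0 \<delta> \<times> ?Q) (\<lambda>z. \<rho> (snd z))" and c2: "continuous_on (ball 0 \<delta> \<times> ?Q) (\<lambda>z. \<eta> (snd z))"
      by (auto intro!: continuous_on_compose2[OF r(1)] continuous_on_compose2[OF e] continuous_intros)
    show "continuous_on (ball 0 \<delta> \<times> ?Q) (\<lambda>(t, x). \<eta> x * ln (\<rho> x + t * \<eta> x))"
      unfolding case_prod_beta
      by (intro continuous_intros c1 c2) (use pos in \<open>force simp: less_imp_neq[symmetric]\<close>)
  qed (use d in auto)
  then have "((\<lambda>t. integral ?Q (?f t)) has_field_derivative integral ?Q (\<lambda>x. \<eta> x * ln (\<rho> x))) (at 0)"
    using d by (simp add: at_within_open[OF _ open_ball])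
  moreover have "torus_integral (\<lambda>x. \<eta> x * ln (\<rho> x)) = integral ?Q (\<lambda>x. \<eta> x * ln (\<rho> x))"
    using r by (intro torus_integral_continuous continuous_intros rc ec) (auto simp: less_imp_neq[symmetric])
  ultimately have D: "((\<lambda>t. integral ?Q (?f t)) has_field_derivative torus_integral (\<lambda>x. \<eta> x * ln (\<rho> x))) (at 0)"
    by simp
  \<comment> \<open>The Leibniz rule was applied to \<open>integral\<close>; it agrees with
    \<open>torus_integral\<close> for parameters in the ball, which suffices for a derivative at
    0.\<close>
  show ?thesis
  proof (rule has_field_derivative_transform_within_open[OF D open_ball[of 0 \<delta>]])
    show "integral ?Q (?f t) = torus_integral (?f t)" if "t \<in> ball 0 \<delta>" for t
      by (rule torus_integral_continuous(2)[OF cf[OF that], symmetric])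
  qed (use d in auto)
qed

text \<open>Along a line the interaction energy is a quadratic polynomial in the parameter. Symmetry
  of the convolution merges its two mixed terms, which is the origin of the factor 2 in
  \<open>2 * \<beta>\<close>.\<close>

lemma free_energy_has_derivative:
  fixes W \<rho> \<eta> :: "real^'d \<Rightarrow> real"
  assumes W: "interaction_kernel W"
    and r: "continuous_on UNIV \<rho>" "\<And>x. \<rho> x > 0" "periodic \<rho>" and e: "continuous_on UNIV \<eta>" "periodic \<eta>"
    and cV: "continuous_on UNIV (torus_conv W \<rho>)" "continuous_on UNIV (torus_conv W \<eta>)"
  shows "((\<lambda>\<epsilon>. free_energy \<beta> W (\<lambda>x. \<rho> x + \<epsilon> * \<eta> x)) has_real_derivative
    torus_integral (\<lambda>x. \<eta> x * (ln (\<rho> x) - 2 * \<beta> * torus_conv W \<rho> x))) (at 0)"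
proof -
  let ?T = torus_integral and ?V = "torus_conv W \<rho>" and ?U = "torus_conv W \<eta>"
  have pW: "periodic W" using W unfolding interaction_kernel_def by blast
  note bW = interaction_kernel_bounded_borel[OF W]
  have br: "bounded_borel \<rho>" and be: "bounded_borel \<eta>"
    using r e by (auto intro: bounded_borel_continuous_periodic)
  have bV: "bounded_borel ?V" and bU: "bounded_borel ?U"
    using cV periodic_torus_conv[OF pW] by (auto intro: bounded_borel_continuous_periodic)
  note I = bounded_borel_integrable[OF bounded_borel_mult]
  have conv: "torus_conv W (\<lambda>x. \<rho> x + t * \<eta> x) x = ?V x + t * ?U x" for t x
  proof -
    have "?T (\<lambda>y. W (x - y) * \<rho> y + t * (W (x - y) * \<eta> y)) = ?V x + t * ?U x"
      unfolding torus_conv_def torus_integral_eq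
      using I[OF bounded_borel_reflect[OF bW] br] I[OF bounded_borel_reflect[OF bW] be] by simp
    then show ?thesis by (simp add: torus_conv_def algebra_simps)
  qed
  have sym: "?T (\<lambda>x. \<rho> x * ?U x) = ?T (\<lambda>x. \<eta> x * ?V x)"
    by (rule torus_integral_conv_symmetric[OF bW interaction_kernel_even[OF W] br be])
  have quad: "?T (\<lambda>x. (\<rho> x + t * \<eta> x) * torus_conv W (\<lambda>x. \<rho> x + t * \<eta> x) x)
    = ?T (\<lambda>x. \<rho> x * ?V x) + t * (2 * ?T (\<lambda>x. \<eta> x * ?V x)) + t\<^sup>2 * ?T (\<lambda>x. \<eta> x * ?U x)" for t
  proof -
    have "?T (\<lambda>x. (\<rho> x + t * \<eta> x) * torus_conv W (\<lambda>x. \<rho> x + t * \<eta> x) x)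
      = ?T (\<lambda>x. \<rho> x * ?V x + t * (\<rho> x * ?U x) + t * (\<eta> x * ?V x) + t\<^sup>2 * (\<eta> x * ?U x))"
      by (simp add: conv algebra_simps power2_eq_square)
    also have "\<dots> = ?T (\<lambda>x. \<rho> x * ?V x) + t * ?T (\<lambda>x. \<rho> x * ?U x) + t * ?T (\<lambda>x. \<eta> x * ?V x) + t\<^sup>2 * ?T (\<lambda>x. \<eta> x * ?U x)"
      unfolding torus_integral_eq
      using I[OF br bV] I[OF br bU] I[OF be bV] I[OF be bU] by simp
    finally show ?thesis unfolding sym by simp
  qed
  have bl: "bounded_borel (\<lambda>x. ln (\<rho> x))"
  proof (rule bounded_borel_continuous_periodic)
    show "continuous_on UNIV (\<lambda>x. ln (\<rho> x))"
      using r by (auto intro!: continuous_intros simp: less_imp_neq[symmetric])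
    show "periodic (\<lambda>x. ln (\<rho> x))" using r by (simp add: periodic_def)
  qed
  have "((\<lambda>t. free_energy \<beta> W (\<lambda>x. \<rho> x + t * \<eta> x)) has_real_derivative
    ?T (\<lambda>x. \<eta> x * ln (\<rho> x)) - \<beta> * (2 * ?T (\<lambda>x. \<eta> x * ?V x))) (at 0)"
    unfolding free_energy_def quad
    by (rule derivative_eq_intros refl entropy_has_derivative r e | simp)+
  moreover have "?T (\<lambda>x. \<eta> x * ln (\<rho> x)) - \<beta> * (2 * ?T (\<lambda>x. \<eta> x * ?V x))
    = ?T (\<lambda>x. \<eta> x * (ln (\<rho> x) - 2 * \<beta> * ?V x))"
  proof -
    have "?T (\<lambda>x. \<eta> x * (ln (\<rho> x) - 2 * \<beta> * ?V x)) = ?T (\<lambda>x. \<eta> x * ln (\<rho> x) - (2 * \<beta>) * (\<eta> x * ?V x))"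
      by (simp add: algebra_simps)
    also have "\<dots> = ?T (\<lambda>x. \<eta> x * ln (\<rho> x)) - \<beta> * (2 * ?T (\<lambda>x. \<eta> x * ?V x))"
      unfolding torus_integral_eq using I[OF be bl] I[OF be bV] by simp
    finally show ?thesis by simp
  qed
  ultimately show ?thesis by simp
qed

text \<open>Integrating the \<open>i\<close>-th partial derivative of \<open>u * q i\<close> gives 0
  without boundary terms, by periodicity. Summation over \<open>i\<close> and harmonicity leave a
  vanishing sum of nonnegative integrals, so the gradient is zero.\<close>

lemma periodic_harmonic_constant:
  fixes u :: "real^'d \<Rightarrow> real"
  assumes p: "periodic u" and C2: "Ck 2 u" and h: "\<And>x. laplacian u x = 0"
  shows "\<exists>c. \<forall>x. u x = c"
proof -
  define q where "q = (\<lambda>i. partial_deriv i u)"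
  have C1: "Ck 1 u" "Ck 1 (q i)" for i
    using C2 Ck_Suc_imp[of 1 u] Ck_SucD(2)[of 1 u] unfolding q_def numeral_2_eq_2 One_nat_def by blast+
  have C0: "continuous_on UNIV u" "continuous_on UNIV (q i)" "continuous_on UNIV (partial_deriv i (q i))" for i
    using C1(1) C1(2)[of i] by (auto simp: differentiable_imp_continuous_on)
  have pq: "periodic (q i)" "periodic (partial_deriv i (q i))" for i
    unfolding q_def by (intro periodic_partial_deriv p)+
  have b: "bounded_borel u" "bounded_borel (q i)" "bounded_borel (partial_deriv i (q i))" for i
    using C0 p pq by (auto intro: bounded_borel_continuous_periodic)
  note I = bounded_borel_integrable[OF bounded_borel_mult]
  have parts: "torus_integral (\<lambda>x. u x * partial_deriv i (q i) x) + torus_integral (\<lambda>x. q i x * q i x) = 0" for i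
  proof -
    have "partial_deriv i (\<lambda>x. u x * q i x) = (\<lambda>x. u x * partial_deriv i (q i) x + q i x * q i x)"
      using C1 unfolding q_def by (intro ext partial_deriv_mult) (auto simp: differentiable_on_def)
    moreover have "torus_integral (partial_deriv i (\<lambda>x. u x * q i x)) = 0"
      using p pq C1 by (intro torus_integral_partial_deriv Ck_mult) (auto simp: periodic_def)
    ultimately show ?thesis
      unfolding torus_integral_eq using I[OF b(1,3)] I[OF b(2,2)] by simp
  qed
  have "(\<Sum>i\<in>UNIV. torus_integral (\<lambda>x. u x * partial_deriv i (q i) x)) = torus_integral (\<lambda>x. u x * laplacian u x)"
    unfolding torus_integral_eq laplacian_def q_def sum_distrib_left
    by (rule Bochner_Integration.integral_sum[symmetric]) (rule I[OF b(1,3), unfolded q_def])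
  also have "\<dots> = 0" by (simp add: h)
  finally have "(\<Sum>i\<in>UNIV. torus_integral (\<lambda>x. q i x * q i x)) = 0"
    using sum.distrib[of "\<lambda>i. torus_integral (\<lambda>x. u x * partial_deriv i (q i) x)" "\<lambda>i. torus_integral (\<lambda>x. q i x * q i x)" UNIV]
    by (simp add: parts)
  then have "torus_integral (\<lambda>x. q i x * q i x) = 0" for i
    by (subst (asm) sum_nonneg_eq_0_iff) (auto simp: torus_integral_eq)
  then have "q i x * q i x = 0" for i x
    by (intro torus_integral_eq_0_imp[of "\<lambda>x. q i x * q i x"])
      (use C0 pq in \<open>auto intro!: continuous_intros simp: periodic_def\<close>)
  then have q0: "partial_deriv i u x = 0" for i x by (simp add: q_def)
  have "(u has_derivative (\<lambda>h. 0)) (at x)" for x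
    using has_derivative_partials[of u x] C1 by (simp add: q0 differentiable_on_def)
  then show ?thesis using has_derivative_zero_constant[of UNIV u] by auto
qed

subsection \<open>Stationary states\<close>

text \<open>The potential \<open>g\<close> represents the first variation. If \<open>g\<close> is
  constant, the variation is this constant times the mass of the direction, which is 0.\<close>

lemma critical_point_iff_constant_potential:
  fixes W \<rho> :: "real^'d \<Rightarrow> real"
  assumes W: "interaction_kernel W"
    and r: "periodic \<rho>" "smooth \<rho>" "\<And>x. \<rho> x > 0" "torus_integral \<rho> = M"
  shows "mass_constrained_critical_point \<beta> W M \<rho> \<longleftrightarrow>
    (\<exists>c. \<forall>x. ln (\<rho> x) - 2 * \<beta> * torus_conv W \<rho> x = c)"
proof -
  define g where "g = (\<lambda>x. ln (\<rho> x) - 2 * \<beta> * torus_conv W \<rho> x)"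
  note bW = interaction_kernel_bounded_borel[OF W]
  have pW: "periodic W" using W unfolding interaction_kernel_def by blast
  have conv: "smooth (torus_conv W f)" if "periodic f" "smooth f" for f
    using smooth_torus_conv[OF bW pW] that by blast
  have cont: "continuous_on UNIV f" if "smooth f" for f :: "real^'d \<Rightarrow> real"
    using that Ck_continuous unfolding smooth_def by blast
  have "Ck k (\<lambda>x. ln (\<rho> x) + (- 2 * \<beta>) * torus_conv W \<rho> x)" for k
    using conv[OF r(1,2)] r unfolding smooth_def by (intro Ck_add Ck_mult Ck_const Ck_ln) auto
  then have sg: "Ck k g" for k by (simp add: g_def)
  have pg: "periodic g"
    using r(1) periodic_torus_conv[OF pW, of \<rho>] by (simp add: periodic_def g_def)
  have D: "((\<lambda>\<epsilon>. free_energy \<beta> W (\<lambda>x. \<rho> x + \<epsilon> * \<eta> x)) has_real_derivative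
      torus_integral (\<lambda>x. \<eta> x * g x)) (at 0)" if "periodic \<eta>" "smooth \<eta>" for \<eta>
    unfolding g_def using that r by (intro free_energy_has_derivative W cont conv) auto
  show ?thesis
  proof
    assume crit: "mass_constrained_critical_point \<beta> W M \<rho>"
    \<comment> \<open>The torus has volume 1, so \<open>torus_integral g\<close> is the mean of
      \<open>g\<close> and this direction has zero mass.\<close>
    define \<eta> where "\<eta> = (\<lambda>x. g x + - torus_integral g)"
    have "Ck k \<eta>" for k unfolding \<eta>_def by (intro Ck_add sg Ck_const)
    then have s\<eta>: "smooth \<eta>" by (simp add: smooth_def)
    have p\<eta>: "periodic \<eta>" using pg by (simp add: periodic_def \<eta>_def)
    have bg: "bounded_borel g"
      using sg pg Ck_continuous by (blast intro: bounded_borel_continuous_periodic)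
    have b\<eta>: "bounded_borel \<eta>" by (intro bounded_borel_continuous_periodic cont s\<eta> p\<eta>)
    have "torus_integral \<eta> = torus_integral g + torus_integral (\<lambda>x::real^'d. - torus_integral g)"
      unfolding \<eta>_def torus_integral_eq
      by (intro Bochner_Integration.integral_add bounded_borel_integrable bg bounded_borel_const)
    then have m: "torus_integral \<eta> = 0" by simp
    then have "((\<lambda>\<epsilon>. free_energy \<beta> W (\<lambda>x. \<rho> x + \<epsilon> * \<eta> x)) has_real_derivative 0) (at 0)"
      using crit p\<eta> s\<eta> by (simp add: mass_constrained_critical_point_def)
    with D[OF p\<eta> s\<eta>] have "torus_integral (\<lambda>x. \<eta> x * g x) = 0" by (rule DERIV_unique)
    \<comment> \<open>Split \<open>g\<close> into \<open>\<eta>\<close> and its mean; the mean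
      contributes nothing because \<open>\<eta>\<close> has zero mass, leaving the integral of the
      square of \<open>\<eta>\<close>.\<close>
    moreover have "torus_integral (\<lambda>x. \<eta> x * g x) = torus_integral (\<lambda>x. \<eta> x * \<eta> x + torus_integral g * \<eta> x)"
      by (simp add: \<eta>_def algebra_simps)
    moreover have "\<dots> = torus_integral (\<lambda>x. \<eta> x * \<eta> x) + torus_integral g * torus_integral \<eta>"
      unfolding torus_integral_eq
      using bounded_borel_integrable[OF b\<eta>] bounded_borel_integrable[OF bounded_borel_mult[OF b\<eta> b\<eta>]] by simp
    ultimately have "torus_integral (\<lambda>x. \<eta> x * \<eta> x) = 0" using m by simp
    then have "\<eta> x * \<eta> x = 0" for x
      using cont[OF s\<eta>] p\<eta>
      by (intro torus_integral_eq_0_imp[of "\<lambda>x. \<eta> x * \<eta> x"]) (auto intro!: continuous_intros simp: periodic_def)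
    then have "\<forall>x. g x = torus_integral g" by (simp add: \<eta>_def)
    then show "\<exists>c. \<forall>x. ln (\<rho> x) - 2 * \<beta> * torus_conv W \<rho> x = c"
      unfolding g_def by (rule exI)
  next
    assume "\<exists>c. \<forall>x. ln (\<rho> x) - 2 * \<beta> * torus_conv W \<rho> x = c"
    then obtain c where c: "g = (\<lambda>_. c)" by (auto simp: g_def)
    show "mass_constrained_critical_point \<beta> W M \<rho>"
      unfolding mass_constrained_critical_point_def
    proof (intro conjI allI impI r(4))
      fix \<eta> :: "real^'d \<Rightarrow> real"
      assume \<eta>: "periodic \<eta>" "smooth \<eta>" "torus_integral \<eta> = 0"
      then have "torus_integral (\<lambda>x. \<eta> x * g x) = 0"
        by (simp add: c torus_integral_eq)
      with D[OF \<eta>(1,2)]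
      show "((\<lambda>\<epsilon>. free_energy \<beta> W (\<lambda>x. \<rho> x + \<epsilon> * \<eta> x)) has_real_derivative 0) (at 0)"
        by simp
    qed
  qed
qed

text \<open>For exponential \<open>G\<close> the function under the Laplacian is the exponential of
  the potential. Being periodic and harmonic it is constant, and \<open>exp\<close> is
  injective.\<close>

lemma stationary_iff_constant_potential:
  fixes W \<rho> :: "real^'d \<Rightarrow> real"
  assumes W: "interaction_kernel W" and r: "periodic \<rho>" "smooth \<rho>" "\<And>x. \<rho> x > 0"
  shows "stationary_solution (\<lambda>s. exp (- \<beta> * s)) W \<rho> \<longleftrightarrow>
    (\<exists>c. \<forall>x. ln (\<rho> x) - 2 * \<beta> * torus_conv W \<rho> x = c)"
proof -
  define u where "u = (\<lambda>x. (exp (- \<beta> * torus_conv W \<rho> x))\<^sup>2 * \<rho> x)"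
  have u: "u x = exp (ln (\<rho> x) - 2 * \<beta> * torus_conv W \<rho> x)" for x
  proof -
    have "exp (ln (\<rho> x) - 2 * \<beta> * torus_conv W \<rho> x) = exp (2 * (- \<beta> * torus_conv W \<rho> x)) * exp (ln (\<rho> x))"
      by (simp add: exp_add[symmetric])
    also have "\<dots> = u x"
      unfolding exp_double u_def using r(3)[of x] by simp
    finally show ?thesis by simp
  qed
  have pW: "periodic W" using W unfolding interaction_kernel_def by blast
  have "smooth (torus_conv W \<rho>)"
    by (rule smooth_torus_conv[OF interaction_kernel_bounded_borel[OF W] pW r(1,2)])
  then have "Ck 2 (\<lambda>x. exp (ln (\<rho> x) + (- 2 * \<beta>) * torus_conv W \<rho> x))"
    using r unfolding smooth_def by (intro Ck_exp Ck_add Ck_mult Ck_const Ck_ln) auto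
  then have C2: "Ck 2 u" by (simp add: u[abs_def] del: Ck.simps)
  have pu: "periodic u"
    using r(1) periodic_torus_conv[OF pW, of \<rho>] by (simp add: periodic_def u_def)
  have "stationary_solution (\<lambda>s. exp (- \<beta> * s)) W \<rho> \<longleftrightarrow> (\<forall>x. laplacian u x = 0)"
    by (simp add: stationary_solution_def u_def)
  also have "\<dots> \<longleftrightarrow> (\<exists>c. \<forall>x. u x = c)"
  proof
    assume "\<forall>x. laplacian u x = 0"
    then show "\<exists>c. \<forall>x. u x = c" by (intro periodic_harmonic_constant pu C2) auto
  next
    assume "\<exists>c. \<forall>x. u x = c"
    then obtain c where "u = (\<lambda>_. c)" by auto
    then show "\<forall>x. laplacian u x = 0" by (simp add: laplacian_def partial_deriv_const)
  qed
  also have "\<dots> \<longleftrightarrow> (\<exists>c. \<forall>x. ln (\<rho> x) - 2 * \<beta> * torus_conv W \<rho> x = c)"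
    unfolding u by (metis ln_exp)
  finally show ?thesis .
qed

text \<open>Exponentiation gives \<open>\<rho>\<close> up to the factor \<open>exp c\<close>, and
  integration fixes that factor through the mass. Conversely \<open>c\<close> is the logarithm of
  the mass over the normalizing integral.\<close>

lemma constant_potential_iff_self_consistent:
  fixes \<rho> V :: "real^'d \<Rightarrow> real"
  assumes pos: "\<And>x. \<rho> x > 0" and M: "M > 0" "torus_integral \<rho> = M"
  shows "(\<exists>c. \<forall>x. ln (\<rho> x) - V x = c) \<longleftrightarrow>
    (\<forall>x. \<rho> x = M * (exp (V x) / torus_integral (\<lambda>z. exp (V z))))"
proof
  assume "\<exists>c. \<forall>x. ln (\<rho> x) - V x = c"
  then obtain c where "\<And>x. ln (\<rho> x) = c + V x" by (metis add.commute diff_add_cancel)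
  then have r: "\<rho> x = exp c * exp (V x)" for x by (metis exp_add exp_ln pos)
  have "torus_integral \<rho> = torus_integral (\<lambda>x. exp c * exp (V x))"
    by (intro arg_cong[where f = torus_integral] ext r)
  \<comment> \<open>As \<open>M\<close> is positive, the normalizing integral is nonzero and one may
    divide by it.\<close>
  then have "M = exp c * torus_integral (\<lambda>z. exp (V z))"
    using M(2) by (simp add: torus_integral_eq)
  with M(1) r show "\<forall>x. \<rho> x = M * (exp (V x) / torus_integral (\<lambda>z. exp (V z)))"
    by (auto simp: field_simps)
next
  let ?Z = "torus_integral (\<lambda>z. exp (V z))"
  assume r: "\<forall>x. \<rho> x = M * (exp (V x) / ?Z)"
  \<comment> \<open>\<open>?Z = 0\<close> would make the quotient 0 by convention and a negative
    \<open>?Z\<close> would make it negative, both contradicting positivity of \<open>\<rho>\<close>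
    at 0.\<close>
  have "?Z > 0"
    using r pos[of 0] M(1) by (auto simp: zero_less_mult_iff zero_less_divide_iff mult_less_0_iff)
  then have "ln (\<rho> x) - V x = ln (M / ?Z)" for x
    using M(1) r by (simp add: ln_mult ln_div)
  then show "\<exists>c. \<forall>x. ln (\<rho> x) - V x = c" by blast
qed

theorem proposition3:
  fixes W \<rho> :: "real^'d \<Rightarrow> real" and G :: "real \<Rightarrow> real" and \<beta> M :: real
  assumes "interaction_kernel W"
    and "\<beta> > 0" and "M > 0"
    and "G = (\<lambda>s. exp (- \<beta> * s))"
    and "periodic \<rho>" and "smooth \<rho>" and "\<forall>x. \<rho> x > 0"
    and "torus_integral \<rho> = M"
  shows "(stationary_solution G W \<rho> \<longleftrightarrow> mass_constrained_critical_point \<beta> W M \<rho>)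
    \<and> (mass_constrained_critical_point \<beta> W M \<rho> \<longleftrightarrow>
         (\<exists>c::real. \<forall>x. ln (\<rho> x) - 2 * \<beta> * torus_conv W \<rho> x = c))
    \<and> ((\<exists>c::real. \<forall>x. ln (\<rho> x) - 2 * \<beta> * torus_conv W \<rho> x = c) \<longleftrightarrow>
         (\<forall>x. \<rho> x = M * (exp (2 * \<beta> * torus_conv W \<rho> x)
                  / torus_integral (\<lambda>z. exp (2 * \<beta> * torus_conv W \<rho> z)))))"
proof -
  have pos: "\<And>x. \<rho> x > 0" using assms(7) by blast
  \<comment> \<open>Constancy of the potential is the hub: each of the other three conditions has
    been shown equivalent to it.\<close>
  show ?thesis
    unfolding assms(4) stationary_iff_constant_potential[OF assms(1,5,6) pos]
      critical_point_iff_constant_potential[OF assms(1,5,6) pos assms(8)]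
      constant_potential_iff_self_consistent[OF pos assms(3,8), of "\<lambda>x. 2 * \<beta> * torus_conv W \<rho> x"]
    by simp
qed

end
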